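(* Fix the balance parameter $p = 0.5$, the number $r$ of vertices (a positive integer), and the dimension $n$ (a positive integer). Draw a random set $F$ from the distribution $\mathrm{Face}(p, r, n)$. Then $$ \mathbb{P}\left\{ F \text{ is a simplicial face of } \mathcal{E}_n \text{ with dimension } r-1 \right\} \;\geq\; 1 - r^2 \exp\left( \frac{-n}{r^2} \right). $$
   Context: The elliptope $\mathcal{E}_n$ is the convex set of all $n \times n$ real symmetric positive-semidefinite matrices whose diagonal entries are all equal to one. The signed Bernoulli distribution $\mathrm{SBern}(p)$ with parameter $p \in [0,1]$ takes the value $+1$ with probability $p$ and the value $-1$ with probability $1-p$. A random vector with distribution $\mathrm{SBern}(p,n)$ takes values in $\{\pm 1\}^n$ and has $n$ independent entries, each with distribution $\mathrm{SBern}(p)$. The random model $\mathrm{Face}(p,r,n)$: draw (column) random vectors $\boldsymbol{\xi}_1, \dots, \boldsymbol{\xi}_r$ independently from $\mathrm{SBern}(p,n)$ and set $$F := \operatorname{conv}\{ \boldsymbol{\xi}_1 \boldsymbol{\xi}_1^{\mathsf{t}}, \dots, \boldsymbol{\xi}_r \boldsymbol{\xi}_r^{\mathsf{t}} \} \subset \mathcal{E}_n,$$ where ${}^{\mathsf{t}}$ is the transpose and $\operatorname{conv}$ the convex hull. The dimension of a convex set is the dimension of its affine hull. A face $F$ of a convex set $K$ is a convex subset of $K$ such that whenever $x, y \in K$ and $\theta x + (1-\theta) y \in F$ for some $\theta \in (0,1)$, it follows that $x, y \in F$. A $k$-dimensional face of a convex set is simplicial if it is the convex hull of an affinely independent family of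 $k+1$ points. *)

theory Defs
  imports "HOL-Probability.Probability"
begin

definition positive_semidefinite :: "real^'n^'n \<Rightarrow> bool" where
  "positive_semidefinite A \<longleftrightarrow> (\<forall>x. 0 \<le> x \<bullet> (A *v x))"

definition elliptope :: "(real^'n^'n) set" where
  "elliptope = {A. transpose A = A \<and> positive_semidefinite A \<and> (\<forall>i. A $ i $ i = 1)}"

text \<open>The dimension of a set is that of its affine hull (\<open>aff_dim\<close>), and \<open>k simplex F\<close> says
  that \<open>F\<close> is the convex hull of an affinely independent set of \<open>k + 1\<close> points.\<close>

definition simplicial_face_of :: "int \<Rightarrow> 'a::euclidean_space set \<Rightarrow> 'a set \<Rightarrow> bool" where
  "simplicial_face_of k F K \<longleftrightarrow> F face_of K \<and> aff_dim F = k \<and> k simplex F"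

text \<open>Signed Bernoulli law, meant for \<open>p\<close> in \<open>[0,1]\<close> (\<open>bernoulli_pmf\<close> clips other values).\<close>

definition sbern_pmf :: "real \<Rightarrow> real pmf" where
  "sbern_pmf p = map_pmf (\<lambda>b. if b then 1 else - 1) (bernoulli_pmf p)"

text \<open>In \<open>Pi_pmf A d P\<close> the components indexed by \<open>A\<close> are independent with laws \<open>P\<close>; the value
  \<open>d\<close>, taken outside \<open>A\<close>, plays no role below.\<close>

definition sbern_vec_pmf :: "real \<Rightarrow> (real^'n) pmf" where
  "sbern_vec_pmf p = map_pmf (\<lambda>f. \<chi> i. f i) (Pi_pmf UNIV 0 (\<lambda>_. sbern_pmf p))"

definition outer_square :: "real^'n \<Rightarrow> real^'n^'n" where
  "outer_square x = (\<chi> i j. x $ i * x $ j)"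

text \<open>The law of the random set \<open>F\<close> in the model \<open>Face(p, r, n)\<close>, with \<open>n = CARD('n)\<close>.\<close>

definition face_pmf :: "real \<Rightarrow> nat \<Rightarrow> (real^'n^'n) set pmf" where
  "face_pmf p r =
     map_pmf (\<lambda>\<xi>. convex hull ((\<lambda>i. outer_square (\<xi> i)) ` {1..r}))
       (Pi_pmf {1..r} 0 (\<lambda>_. sbern_vec_pmf p))"

end

theory Submission
  imports Defs
begin

text \<open>
  Write \<open>s\<^sub>1, \<dots>, s\<^sub>r\<close> for the drawn sign vectors and \<open>e\<^sub>k \<in> {1, -1}\<^sup>r\<close> for the \<open>k\<close>-th row of the
  \<open>n \<times> r\<close> matrix with these columns. Call an \<open>r \<times> r\<close> matrix balanced if it is symmetric with
  constant diagonal; the space of these matrices contains every \<open>e e\<^sup>t\<close> with \<open>e\<close> a sign vector.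

  \<^emph>\<open>Geometry.\<close> If the matrices \<open>e\<^sub>k e\<^sub>k\<^sup>t\<close> span the balanced matrices, then the convex hull of the
  \<open>s\<^sub>i s\<^sub>i\<^sup>t\<close> is a simplicial face (\<open>simplicial_face_of_elliptope\<close>). Indeed, let a segment in the
  elliptope meet the hull in its interior. Its end points are positive semidefinite and their
  quadratic forms vanish wherever that of the interior point does, in particular on the orthogonal
  complement of the \<open>s\<^sub>i\<close>. So an end point has the form \<open>\<Sum>\<^sub>i\<^sub>j A\<^sub>i\<^sub>j s\<^sub>i s\<^sub>j\<^sup>t\<close> with \<open>A\<close> positive
  semidefinite, and its unit diagonal says \<open>e\<^sub>k\<^sup>t A e\<^sub>k = 1\<close> for each \<open>k\<close>. As the \<open>e\<^sub>k e\<^sub>k\<^sup>t\<close> span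
  the balanced matrices, these equations force \<open>A\<close> to be diagonal with trace one, so the end
  point is a convex combination of the \<open>s\<^sub>i s\<^sub>i\<^sup>t\<close>.

  \<^emph>\<open>Probability.\<close> At balance one half the rows \<open>e\<^sub>1, \<dots>, e\<^sub>n\<close> are independent and uniform on the
  cube (\<open>sign_columns_conv_rows\<close>). Reveal them one at a time and let \<open>D\<close> be the codimension, within
  the balanced matrices, of the span of the \<open>e\<^sub>k e\<^sub>k\<^sup>t\<close> seen so far. The law of \<open>e e\<^sup>t\<close> is spread in
  all balanced directions: \<open>E \<langle>C, e e\<^sup>t\<rangle>\<^sup>2 \<ge> \<parallel>C\<parallel>\<^sup>2\<close>
  (\<open>balanced_quadratic_second_moment\<close>). Summing this over an orthonormal basis of the missing
  directions, the expected squared length of the projection of \<open>e e\<^sup>t\<close> to them is at least \<open>D\<close>, while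
  this length squared never exceeds \<open>\<parallel>e e\<^sup>t\<parallel>\<^sup>2 = r\<^sup>2\<close>. Hence a new row leaves the current
  span with probability at least \<open>D / r\<^sup>2\<close>, the expectation of \<open>D\<close> shrinks by the factor
  \<open>1 - 1 / r\<^sup>2\<close> per row, and after \<open>n\<close> rows it is at most \<open>r\<^sup>2 exp (- n / r\<^sup>2)\<close>. By Markov's
  inequality this bounds the probability that \<open>D\<close> is still positive (\<open>prob_span_eq_ge\<close>).
\<close>

section \<open>Quadratic forms and the elliptope\<close>

lemma inner_matrix_vector_outer_square:
  "v \<bullet> (outer_square s *v w) = (s \<bullet> v) * (s \<bullet> w)"
proof -
  have "outer_square s *v w = (s \<bullet> w) *\<^sub>R s"
    by (simp add: vec_eq_iff outer_square_def matrix_vector_mult_def inner_vec_def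
        sum_distrib_right sum_distrib_left mult_ac)
  then show ?thesis by (simp add: inner_commute)
qed

lemma symmetric_inner_matrix_vector:
  fixes A :: "real^'n^'n"
  assumes "transpose A = A"
  shows "v \<bullet> (A *v w) = w \<bullet> (A *v v)"
  using assms by (metis dot_lmul_matrix inner_commute vector_transpose_matrix)

text \<open>The vector \<open>v\<close> minimises the quadratic form, so the gradient \<open>2 A v\<close> vanishes there. The
  proof compares \<open>v\<close> with a small step along the gradient.\<close>

lemma positive_semidefinite_kernel:
  fixes A :: "real^'n^'n"
  assumes sym: "transpose A = A" and psd: "positive_semidefinite A" and v: "v \<bullet> (A *v v) = 0"
  shows "A *v v = 0"
proof -
  define y where "y = A *v v"
  define a where "a = y \<bullet> y"
  define b where "b = y \<bullet> (A *v y)"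
  \<comment> \<open>The step length \<open>- a / b\<close> minimises the form on the line; the summand one avoids division by zero.\<close>
  define t where "t = - a / (b + 1)"
  have b: "b \<ge> 0" using psd by (simp add: b_def positive_semidefinite_def)
  have "0 \<le> (v + t *\<^sub>R y) \<bullet> (A *v (v + t *\<^sub>R y))"
    using psd by (simp add: positive_semidefinite_def)
  also have "\<dots> = 2 * t * a + t\<^sup>2 * b"
    using v symmetric_inner_matrix_vector[OF sym, of v y]
    by (simp add: matrix_vector_right_distrib matrix_vector_mult_scaleR inner_add_left
        inner_add_right a_def b_def y_def power2_eq_square algebra_simps)
  also have "\<dots> = - (a\<^sup>2 * (b + 2) / (b + 1)\<^sup>2)"
    using b by (simp add: t_def power2_eq_square divide_simps) (simp add: algebra_simps)
  finally have "a\<^sup>2 * (b + 2) / (b + 1)\<^sup>2 \<le> 0" by simp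
  then have "a = 0"
    using b by (simp add: divide_le_0_iff mult_le_0_iff)
  then show ?thesis by (simp add: a_def y_def)
qed

lemma convex_elliptope: "convex (elliptope :: (real^'n^'n) set)"
proof (rule convexI)
  fix x y :: "real^'n^'n" and u v :: real
  assume x: "x \<in> elliptope" and y: "y \<in> elliptope" and uv: "0 \<le> u" "0 \<le> v" "u + v = 1"
  have "transpose (u *\<^sub>R x + v *\<^sub>R y) = u *\<^sub>R transpose x + v *\<^sub>R transpose y"
    by (simp add: vec_eq_iff transpose_def)
  moreover have "0 \<le> w \<bullet> ((u *\<^sub>R x + v *\<^sub>R y) *v w)" for w
    using x y uv by (simp add: elliptope_def positive_semidefinite_def inner_add_right
        matrix_vector_mult_add_rdistrib scaleR_matrix_vector_assoc[symmetric])
  ultimately show "u *\<^sub>R x + v *\<^sub>R y \<in> elliptope"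
    using x y uv by (simp add: elliptope_def positive_semidefinite_def)
qed

lemma outer_square_in_elliptope:
  assumes "\<And>k. s $ k \<in> {1, -1}"
  shows "outer_square s \<in> elliptope"
proof -
  have "s $ k * s $ k = 1" for k using assms[of k] by auto
  then show ?thesis
    by (auto simp: elliptope_def positive_semidefinite_def inner_matrix_vector_outer_square)
       (simp_all add: outer_square_def transpose_def vec_eq_iff mult.commute)
qed

section \<open>Sign vectors whose rows span the balanced matrices\<close>

definition balanced :: "'i set \<Rightarrow> ('i \<Rightarrow> 'i \<Rightarrow> real) \<Rightarrow> bool" where
  "balanced I c \<longleftrightarrow> (\<forall>a\<in>I. \<forall>b\<in>I. c a b = c b a \<and> c a a = c b b)"

text \<open>The matrices \<open>f k (f k)\<^sup>t\<close> span the balanced matrices. This is stated by entries, because the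
  index set \<open>I\<close> is not a type and balanced matrices over it are not elements of a vector space type.\<close>

definition rows_span_balanced :: "'i set \<Rightarrow> ('n::finite \<Rightarrow> 'i \<Rightarrow> real) \<Rightarrow> bool" where
  "rows_span_balanced I f \<longleftrightarrow> (\<forall>c. balanced I c \<longrightarrow>
     (\<exists>u. \<forall>a\<in>I. \<forall>b\<in>I. (\<Sum>k\<in>UNIV. u k * (f k a * f k b)) = c a b))"

locale balanced_sign_vectors =
  fixes I :: "'i set" and s :: "'i \<Rightarrow> real^'n"
  assumes finite: "finite I"
    and sign: "i \<in> I \<Longrightarrow> s i $ k \<in> {1, -1}"
    and span: "rows_span_balanced I (\<lambda>k i. s i $ k)"
begin

lemma weights:
  assumes "balanced I c"
  obtains u where "\<And>a b. a \<in> I \<Longrightarrow> b \<in> I \<Longrightarrow> (\<Sum>k\<in>UNIV. u k * (s a $ k * s b $ k)) = c a b"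
  using span assms unfolding rows_span_balanced_def by blast

text \<open>The identity matrix is balanced. If \<open>u\<close> represents it, then the vectors \<open>s j\<close>, reweighted
  coordinatewise by \<open>u\<close>, are dual to the \<open>s i\<close>.\<close>

lemma dual_vectors:
  obtains w :: "'i \<Rightarrow> real^'n"
  where "\<And>i j. i \<in> I \<Longrightarrow> j \<in> I \<Longrightarrow> s i \<bullet> w j = (if i = j then 1 else 0)"
proof -
  have "balanced I (\<lambda>a b. if a = b then 1 else 0)"
    by (auto simp: balanced_def)
  then obtain u where
    u: "\<And>a b. a \<in> I \<Longrightarrow> b \<in> I \<Longrightarrow>
      (\<Sum>k\<in>UNIV. u k * (s a $ k * s b $ k)) = (if a = b then 1 else 0)"
    by (rule weights) blast
  show thesis
    by (rule that[of "\<lambda>j. \<chi> k. u k * s j $ k"])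
       (use u in \<open>simp add: inner_vec_def mult_ac\<close>)
qed

text \<open>The symmetrised matrix unit at \<open>(i, j)\<close> is balanced, hence \<open>\<Sum>\<^sub>k u\<^sub>k e\<^sub>k e\<^sub>k\<^sup>t\<close> for some \<open>u\<close>. Its
  zero diagonal gives \<open>\<Sum>\<^sub>k u\<^sub>k = 0\<close>, so weighting the equations \<open>e\<^sub>k\<^sup>t A e\<^sub>k = 1\<close> by \<open>u\<close> and
  adding them leaves \<open>2 A\<^sub>i\<^sub>j = 0\<close>.\<close>

lemma coefficient_vanishes:
  fixes A :: "'i \<Rightarrow> 'i \<Rightarrow> real"
  assumes sym: "\<And>i j. A i j = A j i"
    and diag: "\<And>k. (\<Sum>i\<in>I. \<Sum>j\<in>I. A i j * (s i $ k * s j $ k)) = 1"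
    and ij: "i \<in> I" "j \<in> I" "i \<noteq> j"
  shows "A i j = 0"
proof -
  define c :: "'i \<Rightarrow> 'i \<Rightarrow> real" where "c a b = (if {a, b} = {i, j} then 1 else 0)" for a b
  have "balanced I c"
    using ij(3) by (auto simp: balanced_def c_def insert_commute doubleton_eq_iff)
  then obtain u where u: "\<And>a b. a \<in> I \<Longrightarrow> b \<in> I \<Longrightarrow> (\<Sum>k\<in>UNIV. u k * (s a $ k * s b $ k)) = c a b"
    by (rule weights) blast
  have "s i $ k * s i $ k = 1" for k using sign[OF ij(1), of k] by auto
  then have "(\<Sum>k\<in>UNIV. u k) = (\<Sum>k\<in>UNIV. u k * (s i $ k * s i $ k))" by simp
  also have "\<dots> = c i i" using u ij by blast
  also have "\<dots> = 0" using ij(3) by (auto simp: c_def)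
  finally have "0 = (\<Sum>k\<in>UNIV. u k * (\<Sum>a\<in>I. \<Sum>b\<in>I. A a b * (s a $ k * s b $ k)))"
    by (simp add: diag)
  also have "\<dots> = (\<Sum>k\<in>UNIV. \<Sum>a\<in>I. \<Sum>b\<in>I. A a b * (u k * (s a $ k * s b $ k)))"
    by (simp add: sum_distrib_left mult_ac)
  also have "\<dots> = (\<Sum>a\<in>I. \<Sum>k\<in>UNIV. \<Sum>b\<in>I. A a b * (u k * (s a $ k * s b $ k)))"
    by (rule sum.swap)
  also have "\<dots> = (\<Sum>a\<in>I. \<Sum>b\<in>I. \<Sum>k\<in>UNIV. A a b * (u k * (s a $ k * s b $ k)))"
    by (intro sum.cong refl sum.swap)
  also have "\<dots> = (\<Sum>a\<in>I. \<Sum>b\<in>I. A a b * c a b)"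
    using u by (simp flip: sum_distrib_left)
  also have "\<dots> = (\<Sum>(a, b)\<in>I \<times> I. A a b * c a b)"
    by (rule sum.cartesian_product)
  also have "\<dots> = (\<Sum>(a, b)\<in>{(i, j), (j, i)}. A a b * c a b)"
    using ij finite by (intro sum.mono_neutral_right) (auto simp: c_def doubleton_eq_iff split: if_splits)
  also have "\<dots> = 2 * A i j"
    using ij(3) sym[of i j] by (simp add: c_def insert_commute)
  finally show ?thesis by simp
qed

text \<open>By the hypothesis \<open>ker\<close>, the matrix \<open>x\<close> annihilates the orthogonal complement of the \<open>s i\<close>,
  so that \<open>x = \<Sum>\<^sub>i\<^sub>j A\<^sub>i\<^sub>j s\<^sub>i s\<^sub>j\<^sup>t\<close>, where \<open>A\<close> is its form on the dual vectors. The unit diagonal of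
  \<open>x\<close> makes \<open>A\<close> diagonal by \<open>coefficient_vanishes\<close>, and then of trace one.\<close>

lemma in_convex_hull:
  assumes x: "x \<in> elliptope"
    and ker: "\<And>v. (\<And>i. i \<in> I \<Longrightarrow> s i \<bullet> v = 0) \<Longrightarrow> v \<bullet> (x *v v) = 0"
  shows "x \<in> convex hull ((\<lambda>i. outer_square (s i)) ` I)"
proof -
  have symx: "transpose x = x" and psd: "positive_semidefinite x" and diag: "\<And>k. x $ k $ k = 1"
    using x by (auto simp: elliptope_def)
  obtain w :: "'i \<Rightarrow> real^'n"
    where w: "\<And>i j. i \<in> I \<Longrightarrow> j \<in> I \<Longrightarrow> s i \<bullet> w j = (if i = j then 1 else 0)"
    by (rule dual_vectors) blast
  define A where "A i j = w i \<bullet> (x *v w j)" for i j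
  have symA: "A i j = A j i" for i j
    unfolding A_def by (rule symmetric_inner_matrix_vector[OF symx])
  have expand: "y \<bullet> (x *v v) = (\<Sum>i\<in>I. (s i \<bullet> v) * (y \<bullet> (x *v w i)))" for y v
  proof -
    \<comment> \<open>Subtracting the dual expansion makes \<open>v\<close> orthogonal to all \<open>s i\<close>.\<close>
    define v' where "v' = v - (\<Sum>i\<in>I. (s i \<bullet> v) *\<^sub>R w i)"
    have "s j \<bullet> v' = 0" if "j \<in> I" for j
    proof -
      have "s j \<bullet> v' = s j \<bullet> v - (\<Sum>i\<in>I. (s i \<bullet> v) * (s j \<bullet> w i))"
        by (simp add: v'_def inner_diff_right inner_sum_right)
      also have "(\<Sum>i\<in>I. (s i \<bullet> v) * (s j \<bullet> w i)) = (\<Sum>i\<in>I. if j = i then s j \<bullet> v else 0)"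
        using w that by (intro sum.cong) auto
      finally show ?thesis using that finite by simp
    qed
    then have "x *v v' = 0"
      by (intro positive_semidefinite_kernel symx psd ker)
    then have "x *v v = (\<Sum>i\<in>I. (s i \<bullet> v) *\<^sub>R (x *v w i))"
      by (simp add: v'_def matrix_vector_mult_diff_distrib linear_sum[OF matrix_vector_mul_linear]
          matrix_vector_mult_scaleR)
    then show ?thesis by (simp add: inner_sum_right)
  qed
  have entry: "x $ k $ l = (\<Sum>i\<in>I. \<Sum>j\<in>I. A i j * (s i $ k * s j $ l))" for k l
  proof -
    have "x $ k $ l = axis k 1 \<bullet> (x *v axis l 1)"
      by (simp add: matrix_vector_mul_component inner_axis inner_axis')
    also have "\<dots> = (\<Sum>j\<in>I. (s j $ l) * (w j \<bullet> (x *v axis k 1)))"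
      by (subst expand) (simp add: inner_axis symmetric_inner_matrix_vector[OF symx, of "axis k 1"])
    also have "\<dots> = (\<Sum>j\<in>I. (s j $ l) * (\<Sum>i\<in>I. (s i $ k) * A j i))"
      by (subst expand) (simp add: inner_axis A_def)
    also have "\<dots> = (\<Sum>j\<in>I. \<Sum>i\<in>I. A i j * (s i $ k * s j $ l))"
      using symA by (simp add: sum_distrib_left mult_ac)
    also have "\<dots> = (\<Sum>i\<in>I. \<Sum>j\<in>I. A i j * (s i $ k * s j $ l))"
      by (rule sum.swap)
    finally show ?thesis .
  qed
  have offdiag: "A i j = 0" if "i \<in> I" "j \<in> I" "i \<noteq> j" for i j
    using coefficient_vanishes[of A, OF symA _ that] entry diag by metis
  have entry': "x $ k $ l = (\<Sum>i\<in>I. A i i * (s i $ k * s i $ l))" for k l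
  proof -
    have "x $ k $ l = (\<Sum>i\<in>I. \<Sum>j\<in>I. if i = j then A i i * (s i $ k * s i $ l) else 0)"
      unfolding entry using offdiag by (intro sum.cong refl) auto
    then show ?thesis using finite by simp
  qed
  have "x = (\<Sum>i\<in>I. A i i *\<^sub>R outer_square (s i))"
    by (simp add: vec_eq_iff entry' outer_square_def)
  also have "\<dots> \<in> convex hull ((\<lambda>i. outer_square (s i)) ` I)"
  proof (rule convex_sum[OF finite convex_convex_hull])
    fix i assume "i \<in> I"
    show "0 \<le> A i i" using psd by (simp add: A_def positive_semidefinite_def)
    show "outer_square (s i) \<in> convex hull ((\<lambda>i. outer_square (s i)) ` I)"
      using \<open>i \<in> I\<close> by (intro hull_inc) auto
  next
    have "s i $ k * s i $ k = 1" if "i \<in> I" for i k using sign[OF that, of k] by auto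
    then show "(\<Sum>i\<in>I. A i i) = 1"
      using entry'[of undefined undefined] diag by simp
  qed
  finally show ?thesis .
qed

text \<open>Two nonnegative quadratic forms with a proper convex combination that vanishes at \<open>v\<close> both
  vanish at \<open>v\<close>; so the end points of a segment that meets the hull satisfy \<open>in_convex_hull\<close>.\<close>

lemma face_of_elliptope: "convex hull ((\<lambda>i. outer_square (s i)) ` I) face_of elliptope"
  (is "?F face_of _")
  unfolding face_of_def
proof (intro conjI ballI impI)
  show "?F \<subseteq> elliptope"
    using sign by (intro hull_minimal convex_elliptope) (auto intro!: outer_square_in_elliptope)
  show "convex ?F" by (rule convex_convex_hull)
  fix x y z :: "real^'n^'n"
  assume x: "x \<in> elliptope" and y: "y \<in> elliptope" and z: "z \<in> ?F" "z \<in> open_segment x y"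
  obtain t where t: "0 < t" "t < 1" "z = (1 - t) *\<^sub>R x + t *\<^sub>R y"
    using z(2) by (auto simp: in_segment)
  have ker: "v \<bullet> (x *v v) = 0 \<and> v \<bullet> (y *v v) = 0" if v: "\<And>i. i \<in> I \<Longrightarrow> s i \<bullet> v = 0" for v
  proof -
    have "convex {m. v \<bullet> (m *v v) = 0}"
      by (rule convexI) (simp add: inner_add_right matrix_vector_mult_add_rdistrib
          scaleR_matrix_vector_assoc[symmetric])
    then have "?F \<subseteq> {m. v \<bullet> (m *v v) = 0}"
      using v by (intro hull_minimal) (auto simp: inner_matrix_vector_outer_square)
    then have "(1 - t) * (v \<bullet> (x *v v)) + t * (v \<bullet> (y *v v)) = 0"
      using z(1) t(3) by (auto simp: inner_add_right matrix_vector_mult_add_rdistrib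
          scaleR_matrix_vector_assoc[symmetric])
    moreover have "0 \<le> v \<bullet> (x *v v)" "0 \<le> v \<bullet> (y *v v)"
      using x y by (auto simp: elliptope_def positive_semidefinite_def)
    ultimately show ?thesis
      using t(1,2) by (simp add: add_nonneg_eq_0_iff)
  qed
  show "x \<in> ?F" "y \<in> ?F"
    using in_convex_hull[OF x] in_convex_hull[OF y] ker by blast+
qed

text \<open>The functional \<open>m \<mapsto> w j \<bullet> (m *v w j)\<close> given by a dual vector is one at the vertex of index \<open>j\<close>
  and zero at the others. So the vertices are distinct and even linearly independent.\<close>

lemma simplex_convex_hull_outer_squares:
  "(int (card I) - 1) simplex convex hull ((\<lambda>i. outer_square (s i)) ` I)"
proof (rule simplex_convex_hull, intro conjI)
  let ?S = "\<lambda>i. outer_square (s i)"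
  obtain w :: "'i \<Rightarrow> real^'n"
    where w: "\<And>i j. i \<in> I \<Longrightarrow> j \<in> I \<Longrightarrow> s i \<bullet> w j = (if i = j then 1 else 0)"
    by (rule dual_vectors) blast
  have q: "w j \<bullet> (?S i *v w j) = (if i = j then 1 else 0)" if "i \<in> I" "j \<in> I" for i j
    using w that by (simp add: inner_matrix_vector_outer_square)
  have inj: "inj_on ?S I"
    using q by (intro inj_onI) (metis zero_neq_one)
  then show "int (card (?S ` I)) = int (card I) - 1 + 1"
    by (simp add: card_image)
  show "\<not> affine_dependent (?S ` I)"
  proof
    assume "affine_dependent (?S ` I)"
    then obtain U j where j: "j \<in> I" "U (?S j) \<noteq> 0" and "(\<Sum>m\<in>?S ` I. U m *\<^sub>R m) = 0"
      using finite by (auto simp: affine_dependent_explicit_finite)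
    then have "(\<Sum>i\<in>I. U (?S i) *\<^sub>R ?S i) = 0"
      using inj by (simp add: sum.reindex)
    then have "0 = w j \<bullet> ((\<Sum>i\<in>I. U (?S i) *\<^sub>R ?S i) *v w j)"
      by simp
    also have "\<dots> = (\<Sum>i\<in>I. U (?S i) * (w j \<bullet> (?S i *v w j)))"
      by (induction rule: infinite_finite_induct)
         (simp_all add: inner_add_right matrix_vector_mult_add_rdistrib
          scaleR_matrix_vector_assoc[symmetric])
    also have "\<dots> = (\<Sum>i\<in>I. if i = j then U (?S j) else 0)"
      using q j(1) by (intro sum.cong) auto
    also have "\<dots> = U (?S j)" using j(1) finite by simp
    finally show False using j(2) by simp
  qed
qed

theorem simplicial_face_of_elliptope:
  "simplicial_face_of (int (card I) - 1) (convex hull ((\<lambda>i. outer_square (s i)) ` I)) elliptope"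
  unfolding simplicial_face_of_def
  using face_of_elliptope simplex_convex_hull_outer_squares aff_dim_simplex by blast

end

section \<open>Spanning a subspace by independent random vectors\<close>

text \<open>Bessel's inequality.\<close>

lemma sum_inner_orthonormal_le:
  fixes S :: "'v::real_inner set"
  assumes "finite S" "pairwise orthogonal S" "\<And>b. b \<in> S \<Longrightarrow> norm b = 1"
  shows "(\<Sum>b\<in>S. (b \<bullet> x)\<^sup>2) \<le> (norm x)\<^sup>2"
proof -
  define p where "p = (\<Sum>b\<in>S. (b \<bullet> x) *\<^sub>R b)"
  have "b \<bullet> p = b \<bullet> x" if "b \<in> S" for b
  proof -
    have "b \<bullet> p = (\<Sum>c\<in>S. (c \<bullet> x) * (b \<bullet> c))"
      by (simp add: p_def inner_sum_right)
    also have "\<dots> = (\<Sum>c\<in>S. if c = b then b \<bullet> x else 0)"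
      using assms that
      by (intro sum.cong refl) (auto simp: pairwise_def orthogonal_def norm_eq_1)
    finally show ?thesis using assms that by simp
  qed
  then have pp: "p \<bullet> p = (\<Sum>b\<in>S. (b \<bullet> x)\<^sup>2)"
    by (subst p_def) (simp add: inner_sum_left power2_eq_square)
  have px: "p \<bullet> x = (\<Sum>b\<in>S. (b \<bullet> x)\<^sup>2)"
    by (simp add: p_def inner_sum_left power2_eq_square)
  have "0 \<le> (x - p) \<bullet> (x - p)" by simp
  also have "\<dots> = (norm x)\<^sup>2 - (\<Sum>b\<in>S. (b \<bullet> x)\<^sup>2)"
    by (simp add: inner_diff_left inner_diff_right pp px power2_norm_eq_inner inner_commute[of x p])
  finally show ?thesis by simp
qed

lemma expectation_pair_pmf_finite:
  fixes h :: "'a \<times> 'b \<Rightarrow> real"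
  assumes "finite (set_pmf p)" "finite (set_pmf q)"
  shows "measure_pmf.expectation (pair_pmf p q) h =
    measure_pmf.expectation q (\<lambda>f. measure_pmf.expectation p (\<lambda>y. h (y, f)))"
proof -
  have "pair_pmf p q = bind_pmf q (\<lambda>f. map_pmf (\<lambda>y. (y, f)) p)"
    unfolding pair_pmf_def map_pmf_def by (rule bind_commute_pmf)
  then show ?thesis
    using assms by (simp add: pmf_expectation_bind[where A = "set_pmf q"]
        integral_measure_pmf[where A = "set_pmf q"])
qed

text \<open>Let \<open>X\<close> be the squared length of the projection of \<open>\<phi> y\<close> to the orthogonal complement of \<open>W\<close>
  in \<open>U\<close>. The second moment hypothesis, summed over an orthonormal basis of this complement, bounds
  the expectation of \<open>X\<close> below by the codimension; above, \<open>X\<close> is at most \<open>B\<close>, and it is zero unless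
  \<open>\<phi> y\<close> escapes from \<open>W\<close>.\<close>

lemma codim_le_prob_escape:
  fixes \<phi> :: "'b \<Rightarrow> 'v::euclidean_space"
  assumes fin: "finite (set_pmf q)" and U: "subspace U" and W: "subspace W" "W \<subseteq> U"
    and bound: "\<And>y. y \<in> set_pmf q \<Longrightarrow> (norm (\<phi> y))\<^sup>2 \<le> B"
    and spread: "\<And>u. u \<in> U \<Longrightarrow> (norm u)\<^sup>2 \<le> measure_pmf.expectation q (\<lambda>y. (u \<bullet> \<phi> y)\<^sup>2)"
  shows "real (dim U) - real (dim W) \<le> B * measure_pmf.prob q {y. \<phi> y \<notin> W}"
proof -
  define C where "C = {u \<in> U. \<forall>w\<in>W. orthogonal w u}"
  have "subspace C"
    using U by (auto simp: C_def subspace_def orthogonal_def inner_add_right)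
  then obtain S where S: "S \<subseteq> C" "pairwise orthogonal S" "\<And>b. b \<in> S \<Longrightarrow> norm b = 1"
      "independent S" "card S = dim C"
    by (rule orthonormal_basis_subspace) blast
  have finS: "finite S" using S(4) by (rule independent_imp_finite)
  have int: "integrable (measure_pmf q) g" for g :: "'b \<Rightarrow> real"
    using fin by (rule integrable_measure_pmf_finite)
  have "dim C + dim W = dim U"
    unfolding C_def using W U by (intro dim_subspace_orthogonal_to_vectors)
  then have "real (dim U) - real (dim W) = (\<Sum>b\<in>S. (norm b)\<^sup>2)"
    using S(3,5) by simp
  also have "\<dots> \<le> (\<Sum>b\<in>S. measure_pmf.expectation q (\<lambda>y. (b \<bullet> \<phi> y)\<^sup>2))"
    using S(1) by (intro sum_mono spread) (auto simp: C_def)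
  also have "\<dots> = measure_pmf.expectation q (\<lambda>y. \<Sum>b\<in>S. (b \<bullet> \<phi> y)\<^sup>2)"
    by (simp add: Bochner_Integration.integral_sum int)
  also have "\<dots> \<le> measure_pmf.expectation q (\<lambda>y. B * indicator {y. \<phi> y \<notin> W} y)"
  proof (rule integral_mono_AE[OF int int], unfold AE_measure_pmf_iff, rule ballI)
    fix y assume y: "y \<in> set_pmf q"
    show "(\<Sum>b\<in>S. (b \<bullet> \<phi> y)\<^sup>2) \<le> B * indicator {y. \<phi> y \<notin> W} y"
    proof (cases "\<phi> y \<in> W")
      case True
      then have "b \<bullet> \<phi> y = 0" if "b \<in> S" for b
        using S(1) that by (auto simp: C_def orthogonal_def inner_commute)
      then show ?thesis using True by simp
    next
      case False
      have "(\<Sum>b\<in>S. (b \<bullet> \<phi> y)\<^sup>2) \<le> (norm (\<phi> y))\<^sup>2"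
        using finS S(2,3) by (rule sum_inner_orthonormal_le)
      then show ?thesis using bound[OF y] False by simp
    qed
  qed
  finally show ?thesis by simp
qed

text \<open>Given the earlier vectors, the next one lowers the codimension by one with probability at
  least codimension over \<open>B\<close>. So the expected codimension contracts by the factor \<open>1 - 1 / B\<close> per
  vector. It starts at the dimension of \<open>U\<close>, which is at most \<open>B\<close> by the escape bound for the zero
  subspace.\<close>

lemma expected_codim_span_le:
  fixes \<phi> :: "'b \<Rightarrow> 'v::euclidean_space"
  assumes fin: "finite (set_pmf q)" and U: "subspace U" and B: "B \<ge> 1"
    and range: "\<And>y. y \<in> set_pmf q \<Longrightarrow> \<phi> y \<in> U"
    and bound: "\<And>y. y \<in> set_pmf q \<Longrightarrow> (norm (\<phi> y))\<^sup>2 \<le> B"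
    and spread: "\<And>u. u \<in> U \<Longrightarrow> (norm u)\<^sup>2 \<le> measure_pmf.expectation q (\<lambda>y. (u \<bullet> \<phi> y)\<^sup>2)"
    and "finite A"
  shows "measure_pmf.expectation (Pi_pmf A d (\<lambda>_. q))
           (\<lambda>f. real (dim U) - real (dim (span ((\<lambda>k. \<phi> (f k)) ` A)))) \<le> B * (1 - 1 / B) ^ card A"
  using \<open>finite A\<close>
proof (induction A rule: finite_induct)
  case empty
  have "real (dim U) - real (dim {0::'v}) \<le> B * measure_pmf.prob q {y. \<phi> y \<notin> {0}}"
    using fin U _ _ bound spread by (rule codim_le_prob_escape) (use U in \<open>auto simp: subspace_0\<close>)
  also have "\<dots> \<le> B * 1"
    using B by (intro mult_left_mono) auto
  finally show ?case by simp
next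
  case (insert k A)
  let ?P = "Pi_pmf A d (\<lambda>_. q)"
  let ?W = "\<lambda>f. span ((\<lambda>k. \<phi> (f k)) ` A)"
  let ?D = "\<lambda>f. real (dim U) - real (dim (?W f))"
  have setP: "set_pmf ?P = PiE_dflt A d (\<lambda>_. set_pmf q)"
    using insert.hyps by (simp add: set_Pi_pmf o_def)
  have finP: "finite (set_pmf ?P)"
    unfolding setP using insert.hyps fin by (intro finite_PiE_dflt)
  have intP: "integrable (measure_pmf ?P) g" for g :: "_ \<Rightarrow> real"
    using finP by (rule integrable_measure_pmf_finite)
  have intq: "integrable (measure_pmf q) g" for g :: "_ \<Rightarrow> real"
    using fin by (rule integrable_measure_pmf_finite)
  have step: "measure_pmf.expectation q
      (\<lambda>y. real (dim U) - real (dim (span ((\<lambda>j. \<phi> ((f(k := y)) j)) ` insert k A)))) \<le> (1 - 1 / B) * ?D f"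
    if f: "f \<in> set_pmf ?P" for f
  proof -
    have "?W f \<subseteq> U"
      using f U range unfolding setP PiE_dflt_def by (intro span_minimal) auto
    then have "?D f \<le> B * measure_pmf.prob q {y. \<phi> y \<notin> ?W f}"
      using bound spread by (intro codim_le_prob_escape[OF fin U subspace_span])
    then have escape: "?D f / B \<le> measure_pmf.prob q {y. \<phi> y \<notin> ?W f}"
      using B by (simp add: field_simps)
    have "(\<lambda>j. \<phi> ((f(k := y)) j)) ` insert k A = insert (\<phi> y) ((\<lambda>j. \<phi> (f j)) ` A)" for y
      using insert.hyps by auto
    then have "real (dim U) - real (dim (span ((\<lambda>j. \<phi> ((f(k := y)) j)) ` insert k A)))
        = ?D f - indicator {y. \<phi> y \<notin> ?W f} y" for y
      by (simp add: dim_span dim_insert)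
    then have "measure_pmf.expectation q
        (\<lambda>y. real (dim U) - real (dim (span ((\<lambda>j. \<phi> ((f(k := y)) j)) ` insert k A))))
        = measure_pmf.expectation q (\<lambda>y. ?D f - indicator {y. \<phi> y \<notin> ?W f} y)"
      by presburger
    also have "\<dots> = ?D f - measure_pmf.prob q {y. \<phi> y \<notin> ?W f}"
      by (subst Bochner_Integration.integral_diff[OF intq intq]) simp
    also have "\<dots> \<le> ?D f - ?D f / B"
      using escape by simp
    also have "\<dots> = (1 - 1 / B) * ?D f"
      by (simp add: left_diff_distrib)
    finally show ?thesis .
  qed
  have "measure_pmf.expectation (Pi_pmf (insert k A) d (\<lambda>_. q))
          (\<lambda>f. real (dim U) - real (dim (span ((\<lambda>k. \<phi> (f k)) ` insert k A))))
      = measure_pmf.expectation ?P (\<lambda>f. measure_pmf.expectation q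
          (\<lambda>y. real (dim U) - real (dim (span ((\<lambda>j. \<phi> ((f(k := y)) j)) ` insert k A)))))"
    by (simp only: Pi_pmf_insert[OF insert.hyps] integral_map_pmf
        expectation_pair_pmf_finite[OF fin finP] prod.case)
  also have "\<dots> \<le> measure_pmf.expectation ?P (\<lambda>f. (1 - 1 / B) * ?D f)"
    by (rule integral_mono_AE[OF intP intP], unfold AE_measure_pmf_iff) (intro ballI step)
  also have "\<dots> = (1 - 1 / B) * measure_pmf.expectation ?P ?D"
    by simp
  also have "\<dots> \<le> (1 - 1 / B) * (B * (1 - 1 / B) ^ card A)"
    using B insert.IH by (intro mult_left_mono) auto
  also have "\<dots> = B * (1 - 1 / B) ^ card (insert k A)"
    using insert.hyps by simp
  finally show ?case .
qed

text \<open>The codimension is a natural number, so its expectation bounds the probability that it is not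
  zero.\<close>

lemma prob_span_eq_ge:
  fixes \<phi> :: "'b \<Rightarrow> 'v::euclidean_space"
  assumes fin: "finite (set_pmf q)" and U: "subspace U" and B: "B \<ge> 1"
    and range: "\<And>y. y \<in> set_pmf q \<Longrightarrow> \<phi> y \<in> U"
    and bound: "\<And>y. y \<in> set_pmf q \<Longrightarrow> (norm (\<phi> y))\<^sup>2 \<le> B"
    and spread: "\<And>u. u \<in> U \<Longrightarrow> (norm u)\<^sup>2 \<le> measure_pmf.expectation q (\<lambda>y. (u \<bullet> \<phi> y)\<^sup>2)"
    and A: "finite A"
  shows "1 - B * exp (- real (card A) / B)
    \<le> measure_pmf.prob (Pi_pmf A d (\<lambda>_. q)) {f. span ((\<lambda>k. \<phi> (f k)) ` A) = U}"
proof -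
  let ?P = "Pi_pmf A d (\<lambda>_. q)"
  let ?W = "\<lambda>f. span ((\<lambda>k. \<phi> (f k)) ` A)"
  let ?D = "\<lambda>f. real (dim U) - real (dim (?W f))"
  have setP: "set_pmf ?P = PiE_dflt A d (\<lambda>_. set_pmf q)"
    using A by (simp add: set_Pi_pmf o_def)
  have finP: "finite (set_pmf ?P)"
    unfolding setP using A fin by (intro finite_PiE_dflt)
  have intP: "integrable (measure_pmf ?P) g" for g :: "_ \<Rightarrow> real"
    using finP by (rule integrable_measure_pmf_finite)
  have "1 - measure_pmf.prob ?P {f. ?W f = U} = measure_pmf.prob ?P (- {f. ?W f = U})"
    using measure_pmf.prob_compl[of "{f. ?W f = U}" ?P] by (simp add: Compl_eq_Diff_UNIV)
  also have "\<dots> = measure_pmf.expectation ?P (indicator (- {f. ?W f = U}))"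
    by simp
  also have "\<dots> \<le> measure_pmf.expectation ?P ?D"
  proof (rule integral_mono_AE[OF intP intP], unfold AE_measure_pmf_iff, rule ballI)
    fix f assume f: "f \<in> set_pmf ?P"
    have sub: "?W f \<subseteq> U"
      using f U range unfolding setP PiE_dflt_def by (intro span_minimal) auto
    show "indicator (- {f. ?W f = U}) f \<le> ?D f"
    proof (cases "?W f = U")
      case False
      then have "dim (?W f) < dim U"
        using sub U by (metis dim_psubset psubsetI span_eq_iff subspace_span)
      then show ?thesis using False by simp
    qed (simp add: indicator_def)
  qed
  also have "\<dots> \<le> B * (1 - 1 / B) ^ card A"
    by (rule expected_codim_span_le) (use assms in auto)
  also have "\<dots> \<le> B * exp (- 1 / B) ^ card A"
    using B exp_ge_add_one_self[of "- 1 / B"] by (intro mult_left_mono power_mono) auto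
  also have "exp (- 1 / B) ^ card A = exp (- real (card A) / B)"
    by (simp flip: exp_of_nat_mult)
  finally show ?thesis by simp
qed

section \<open>Moments of uniform random signs\<close>

text \<open>The value zero outside \<open>I\<close> is the default value of the product law of the columns, so that
  rows and columns describe the same arrays.\<close>

definition sign_cube :: "'i set \<Rightarrow> ('i \<Rightarrow> real) set" where
  "sign_cube I = PiE_dflt I 0 (\<lambda>_. {1, -1})"

lemma finite_sign_cube: "finite I \<Longrightarrow> finite (sign_cube I)"
  unfolding sign_cube_def by (intro finite_PiE_dflt) auto

lemma sign_cube_nonempty: "sign_cube I \<noteq> {}"
  by (simp add: sign_cube_def)

lemma sign_cube_square: "e \<in> sign_cube I \<Longrightarrow> i \<in> I \<Longrightarrow> e i * e i = 1"
  by (auto simp: sign_cube_def PiE_dflt_def)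

abbreviation sign_expectation :: "'i set \<Rightarrow> (('i \<Rightarrow> real) \<Rightarrow> real) \<Rightarrow> real" where
  "sign_expectation I \<equiv> measure_pmf.expectation (pmf_of_set (sign_cube I))"

text \<open>Flipping the sign at \<open>t\<close> preserves the uniform law and negates the integrand.\<close>

lemma sign_expectation_flip_zero:
  assumes "finite I" "t \<in> I" and g: "\<And>e. g (e(t := - e t)) = g e"
  shows "sign_expectation I (\<lambda>e. e t * g e) = 0"
proof -
  let ?flip = "\<lambda>e::'a \<Rightarrow> real. e(t := - e t)"
  have "?flip e \<in> sign_cube I" if "e \<in> sign_cube I" for e
    unfolding sign_cube_def PiE_dflt_def
  proof (intro CollectI allI conjI impI)
    fix i
    show "?flip e i \<in> {1, -1}" if "i \<in> I"
      using sign_cube_square[OF \<open>e \<in> sign_cube I\<close> that] by (auto simp: square_eq_1_iff)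
    show "?flip e i = 0" if "i \<notin> I"
      using \<open>e \<in> sign_cube I\<close> that \<open>t \<in> I\<close> by (auto simp: sign_cube_def PiE_dflt_def)
  qed
  then have "bij_betw ?flip (sign_cube I) (sign_cube I)"
    by (intro bij_betwI[of _ _ _ ?flip]) auto
  then have "map_pmf ?flip (pmf_of_set (sign_cube I)) = pmf_of_set (sign_cube I)"
    using assms by (intro map_pmf_of_set_bij_betw sign_cube_nonempty finite_sign_cube)
  then have "sign_expectation I (\<lambda>e. e t * g e)
      = measure_pmf.expectation (map_pmf ?flip (pmf_of_set (sign_cube I))) (\<lambda>e. e t * g e)"
    by simp
  also have "\<dots> = - sign_expectation I (\<lambda>e. e t * g e)"
    using g by simp
  finally show ?thesis by simp
qed

lemma sign_expectation_cong:
  assumes "finite I" "\<And>e. e \<in> sign_cube I \<Longrightarrow> F e = G e"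
  shows "sign_expectation I F = sign_expectation I G"
  using assms finite_sign_cube[OF assms(1)]
  by (intro Bochner_Integration.integral_cong_AE)
     (auto simp: AE_measure_pmf_iff set_pmf_of_set sign_cube_nonempty)

lemma sign_moment2:
  assumes I: "finite I" and c: "c \<in> I" and d: "d \<in> I"
  shows "sign_expectation I (\<lambda>e. e c * e d) = (if c = d then 1 else 0)"
proof (cases "c = d")
  case True
  have "sign_expectation I (\<lambda>e. e c * e d) = sign_expectation I (\<lambda>e. 1)"
    using sign_cube_square c True by (intro sign_expectation_cong[OF I]) auto
  then show ?thesis using True by simp
next
  case False
  then show ?thesis using sign_expectation_flip_zero[OF I c, of "\<lambda>e. e d"] by simp
qed

lemma sign_moment4:
  assumes I: "finite I" and ab: "a \<in> I" "b \<in> I" "a \<noteq> b" and cd: "c \<in> I" "d \<in> I"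
  shows "sign_expectation I (\<lambda>e. (e a * e b) * (e c * e d)) = (if {c, d} = {a, b} then 1 else 0)"
proof -
  consider "{c, d} = {a, b}" | "a \<notin> {c, d}" | "b \<notin> {c, d}" using ab(3) by fastforce
  then show ?thesis
  proof cases
    case 1
    have "sign_expectation I (\<lambda>e. (e a * e b) * (e c * e d)) = sign_expectation I (\<lambda>e. 1)"
    proof (rule sign_expectation_cong[OF I])
      fix e assume e: "e \<in> sign_cube I"
      have "(e a * e b) * (e c * e d) = (e a * e a) * (e b * e b)"
        using 1 by (auto simp: doubleton_eq_iff)
      then show "(e a * e b) * (e c * e d) = 1"
        using ab sign_cube_square[OF e] by simp
    qed
    then show ?thesis using 1 by simp
  next
    case 2
    then have "{c, d} \<noteq> {a, b}" "c \<noteq> a" "d \<noteq> a" by auto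
    then show ?thesis
      using sign_expectation_flip_zero[OF I ab(1), of "\<lambda>e. e b * (e c * e d)"] ab(3)
      by (simp add: mult.assoc)
  next
    case 3
    then have "{c, d} \<noteq> {a, b}" "c \<noteq> b" "d \<noteq> b" by auto
    then show ?thesis
      using sign_expectation_flip_zero[OF I ab(2), of "\<lambda>e. e a * (e c * e d)"] ab(3)
      by (simp add: mult_ac)
  qed
qed

text \<open>Expand the square into fourth moments. An entry off the diagonal correlates exactly with itself
  and its mirror image, and contributes \<open>2 u\<^sub>a\<^sub>b\<^sup>2\<close>. The diagonal is constant, so its part of the form
  is constant on the cube, and each diagonal entry contributes \<open>card I\<close> times its square. Without a
  constant diagonal the bound fails: a diagonal matrix of trace zero gives the zero form on the
  cube.\<close>

lemma balanced_quadratic_second_moment: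
  assumes I: "finite I" and u: "balanced I u"
  shows "(\<Sum>a\<in>I. \<Sum>b\<in>I. (u a b)\<^sup>2)
    \<le> sign_expectation I (\<lambda>e. (\<Sum>a\<in>I. \<Sum>b\<in>I. u a b * (e a * e b))\<^sup>2)"
proof -
  define K where "K a b = (\<Sum>c\<in>I. \<Sum>d\<in>I. u c d * sign_expectation I (\<lambda>e. (e a * e b) * (e c * e d)))" for a b
  have int: "integrable (measure_pmf (pmf_of_set (sign_cube I))) g" for g :: "_ \<Rightarrow> real"
    by (rule integrable_measure_pmf_finite) (simp add: set_pmf_of_set sign_cube_nonempty finite_sign_cube I)
  have "sign_expectation I (\<lambda>e. (\<Sum>a\<in>I. \<Sum>b\<in>I. u a b * (e a * e b))\<^sup>2)
     = sign_expectation I (\<lambda>e. \<Sum>a\<in>I. \<Sum>b\<in>I. \<Sum>c\<in>I. \<Sum>d\<in>I. u a b * (u c d * ((e a * e b) * (e c * e d))))"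
    by (simp only: power2_eq_square sum_distrib_right)
       (simp only: sum_distrib_left mult_ac)
  also have "\<dots> = (\<Sum>a\<in>I. \<Sum>b\<in>I. u a b * K a b)"
    by (simp add: Bochner_Integration.integral_sum int K_def sum_distrib_left)
  finally have E: "sign_expectation I (\<lambda>e. (\<Sum>a\<in>I. \<Sum>b\<in>I. u a b * (e a * e b))\<^sup>2)
      = (\<Sum>a\<in>I. \<Sum>b\<in>I. u a b * K a b)" .
  have "(u a b)\<^sup>2 \<le> u a b * K a b" if ab: "a \<in> I" "b \<in> I" for a b
  proof (cases "a = b")
    case True
    have "sign_expectation I (\<lambda>e. (e a * e b) * (e c * e d)) = (if c = d then 1 else 0)"
      if "c \<in> I" "d \<in> I" for c d
      unfolding sign_moment2[OF I that, symmetric]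
      by (rule sign_expectation_cong[OF I]) (simp add: True sign_cube_square ab)
    then have "K a b = (\<Sum>c\<in>I. \<Sum>d\<in>I. if c = d then u c c else 0)"
      unfolding K_def by (intro sum.cong) auto
    also have "\<dots> = (\<Sum>c\<in>I. u c c)"
      using I by simp
    also have "\<dots> = (\<Sum>c\<in>I. u a b)"
      using u ab True unfolding balanced_def by (intro sum.cong refl) metis
    finally have "u a b * K a b = real (card I) * (u a b)\<^sup>2"
      by (simp add: power2_eq_square)
    moreover have "1 \<le> card I" using ab I by (simp add: Suc_le_eq card_gt_0_iff) blast
    ultimately show ?thesis
      using mult_right_mono[of 1 "real (card I)" "(u a b)\<^sup>2"] by simp
  next
    case False
    have "K a b = (\<Sum>c\<in>I. \<Sum>d\<in>I. u c d * (if {c, d} = {a, b} then 1 else 0))"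
      unfolding K_def using sign_moment4[OF I ab False] by (intro sum.cong) auto
    also have "\<dots> = (\<Sum>(c, d)\<in>I \<times> I. u c d * (if {c, d} = {a, b} then 1 else 0))"
      by (rule sum.cartesian_product)
    also have "\<dots> = (\<Sum>(c, d)\<in>{(a, b), (b, a)}. u c d * (if {c, d} = {a, b} then 1 else 0))"
      using ab I by (intro sum.mono_neutral_right) (auto simp: doubleton_eq_iff split: if_splits)
    also have "\<dots> = u a b + u b a"
      using False by (simp add: insert_commute)
    also have "\<dots> = 2 * u a b"
      using u ab by (simp add: balanced_def)
    finally show ?thesis by (simp add: power2_eq_square)
  qed
  then show ?thesis unfolding E by (intro sum_mono)
qed

section \<open>Random sign rows span the balanced matrices\<close>

text \<open>The coefficients are indexed by \<open>A\<close> itself, also where \<open>g\<close> takes a value several times.\<close>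

lemma span_image_imp_sum:
  fixes g :: "'a \<Rightarrow> 'v::real_vector"
  assumes "x \<in> span (g ` A)" "finite A"
  shows "\<exists>u. x = (\<Sum>k\<in>A. u k *\<^sub>R g k)"
  using assms(1)
proof (induction rule: span_induct)
  case base
  show ?case unfolding subspace_def
  proof (intro conjI allI ballI; clarsimp)
    show "\<exists>u. (\<Sum>k\<in>A. u k *\<^sub>R g k) = 0" by (rule exI[of _ "\<lambda>_. 0"]) simp
  next
    fix u u'
    show "\<exists>w. (\<Sum>k\<in>A. u k *\<^sub>R g k) + (\<Sum>k\<in>A. u' k *\<^sub>R g k) = (\<Sum>k\<in>A. w k *\<^sub>R g k)"
      by (rule exI[of _ "\<lambda>k. u k + u' k"]) (simp add: scaleR_add_left sum.distrib)
  next
    fix c :: real and u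
    show "\<exists>w. c *\<^sub>R (\<Sum>k\<in>A. u k *\<^sub>R g k) = (\<Sum>k\<in>A. w k *\<^sub>R g k)"
      by (rule exI[of _ "\<lambda>k. c * u k"]) (simp add: scaleR_sum_right)
  qed
next
  case (step x)
  then obtain j where j: "j \<in> A" "x = g j" by auto
  then show ?case
    using assms(2) by (intro exI[of _ "\<lambda>k. if k = j then 1 else 0"])
      (simp add: if_distrib[of "\<lambda>t. t *\<^sub>R _"] cong: if_cong)
qed

text \<open>Matrix units for an embedding of \<open>I\<close> into the index type: they turn a matrix indexed by the set
  \<open>I\<close> into a vector of a Euclidean space, to which the dimension argument applies.\<close>

lemma orthonormal_double_family:
  assumes "finite I" "card I \<le> CARD('n)"
  obtains E :: "'i \<Rightarrow> 'i \<Rightarrow> real^'n^'n"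
  where "\<And>a b c d. a \<in> I \<Longrightarrow> b \<in> I \<Longrightarrow> c \<in> I \<Longrightarrow> d \<in> I \<Longrightarrow>
    E a b \<bullet> E c d = (if a = c \<and> b = d then 1 else 0)"
proof -
  obtain h :: "'i \<Rightarrow> 'n" where h: "inj_on h I"
    using card_le_inj[OF assms(1) _ assms(2)] by auto
  show thesis
    by (rule that[of "\<lambda>a b. axis (h a) (axis (h b) 1)"])
       (use h in \<open>auto simp: inner_axis_axis inj_on_eq_iff\<close>)
qed

text \<open>This is \<open>prob_span_eq_ge\<close> for the space \<open>U\<close> of balanced matrices and \<open>B = (card I)\<^sup>2\<close>, the
  squared norm of \<open>e e\<^sup>t\<close> for a sign vector \<open>e\<close>.\<close>

lemma prob_rows_span_balanced:
  assumes I: "finite I" "I \<noteq> {}" and card: "card I \<le> CARD('n)"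
  shows "1 - (real (card I))\<^sup>2 * exp (- real CARD('n) / (real (card I))\<^sup>2)
    \<le> measure_pmf.prob (Pi_pmf (UNIV :: 'n::finite set) d (\<lambda>_. pmf_of_set (sign_cube I)))
        {f. rows_span_balanced I f}"
proof -
  obtain E :: "'a \<Rightarrow> 'a \<Rightarrow> real^'n^'n"
    where E: "\<And>a b c d. a \<in> I \<Longrightarrow> b \<in> I \<Longrightarrow> c \<in> I \<Longrightarrow> d \<in> I \<Longrightarrow>
      E a b \<bullet> E c d = (if a = c \<and> b = d then 1 else 0)"
    using orthonormal_double_family[OF I(1) card] by blast
  define M where "M c = (\<Sum>a\<in>I. \<Sum>b\<in>I. c a b *\<^sub>R E a b)" for c :: "'a \<Rightarrow> 'a \<Rightarrow> real"
  define U where "U = M ` {c. balanced I c}"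
  define \<phi> where "\<phi> e = M (\<lambda>a b. e a * e b)" for e :: "'a \<Rightarrow> real"
  have entry: "M c \<bullet> E a b = c a b" if ab: "a \<in> I" "b \<in> I" for c a b
  proof -
    have "M c \<bullet> E a b = (\<Sum>i\<in>I. \<Sum>j\<in>I. c i j * (if i = a \<and> j = b then 1 else 0))"
      using E ab by (simp add: M_def inner_sum_left)
    also have "\<dots> = (\<Sum>i\<in>I. \<Sum>j\<in>I. if j = b then if i = a then c a b else 0 else 0)"
      by (intro sum.cong) auto
    also have "\<dots> = c a b" using ab I by simp
    finally show ?thesis .
  qed
  have inner: "M c \<bullet> M c' = (\<Sum>a\<in>I. \<Sum>b\<in>I. c a b * c' a b)" for c c'
    by (subst (2) M_def) (simp add: inner_sum_right entry mult.commute)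
  have normM: "(norm (M c))\<^sup>2 = (\<Sum>a\<in>I. \<Sum>b\<in>I. (c a b)\<^sup>2)" for c
    unfolding power2_norm_eq_inner inner by (simp add: power2_eq_square)
  have U: "subspace U"
    unfolding subspace_def
  proof (intro conjI ballI allI)
    have "M (\<lambda>_ _. 0) = 0" by (simp add: M_def)
    then show "0 \<in> U" unfolding U_def by (intro image_eqI[of _ _ "\<lambda>_ _. 0"]) (auto simp: balanced_def)
  next
    fix x y assume "x \<in> U" "y \<in> U"
    then obtain c c' where c: "balanced I c" "x = M c" and c': "balanced I c'" "y = M c'"
      by (auto simp: U_def)
    have "x + y = M (\<lambda>a b. c a b + c' a b)"
      unfolding c c' by (simp add: M_def scaleR_add_left sum.distrib)
    moreover have "balanced I (\<lambda>a b. c a b + c' a b)"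
      using c(1) c'(1) unfolding balanced_def by metis
    ultimately show "x + y \<in> U" by (auto simp: U_def)
  next
    fix t :: real and x assume "x \<in> U"
    then obtain c where c: "balanced I c" "x = M c" by (auto simp: U_def)
    have "t *\<^sub>R x = M (\<lambda>a b. t * c a b)"
      unfolding c by (simp add: M_def scaleR_sum_right)
    moreover have "balanced I (\<lambda>a b. t * c a b)"
      using c(1) unfolding balanced_def by metis
    ultimately show "t *\<^sub>R x \<in> U" by (auto simp: U_def)
  qed
  have set: "set_pmf (pmf_of_set (sign_cube I)) = sign_cube I"
    using I by (simp add: set_pmf_of_set sign_cube_nonempty finite_sign_cube)
  have range: "\<phi> e \<in> U" if "e \<in> sign_cube I" for e
    unfolding \<phi>_def U_def using that
    by (intro imageI) (simp add: balanced_def sign_cube_square mult.commute)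
  have bound: "(norm (\<phi> e))\<^sup>2 \<le> (real (card I))\<^sup>2" if "e \<in> sign_cube I" for e
    unfolding \<phi>_def normM using that by (simp add: power2_eq_square sign_cube_square
        mult.assoc mult.left_commute[of "e _" "e _" "e _"])
  have spread: "(norm x)\<^sup>2 \<le> sign_expectation I (\<lambda>e. (x \<bullet> \<phi> e)\<^sup>2)" if "x \<in> U" for x
  proof -
    from that obtain c where c: "balanced I c" "x = M c" by (auto simp: U_def)
    then show ?thesis
      using balanced_quadratic_second_moment[OF I(1) c(1)] by (simp add: normM \<phi>_def inner)
  qed
  have "1 \<le> (real (card I))\<^sup>2"
    using I by (simp add: Suc_le_eq card_gt_0_iff)
  then have "1 - (real (card I))\<^sup>2 * exp (- real CARD('n) / (real (card I))\<^sup>2)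
    \<le> measure_pmf.prob (Pi_pmf (UNIV :: 'n set) d (\<lambda>_. pmf_of_set (sign_cube I)))
        {f. span ((\<lambda>k. \<phi> (f k)) ` UNIV) = U}"
    using prob_span_eq_ge[of "pmf_of_set (sign_cube I)" U "(real (card I))\<^sup>2" \<phi> "UNIV :: 'n set" d,
        unfolded set, OF finite_sign_cube[OF I(1)] U _ range bound spread]
    by simp
  also have "\<dots> \<le> measure_pmf.prob (Pi_pmf (UNIV :: 'n set) d (\<lambda>_. pmf_of_set (sign_cube I)))
        {f. rows_span_balanced I f}"
  proof (intro measure_pmf.finite_measure_mono subsetI,
      unfold mem_Collect_eq rows_span_balanced_def, intro allI impI)
    fix f :: "'n \<Rightarrow> 'a \<Rightarrow> real" and c
    assume f: "span (range (\<lambda>k. \<phi> (f k))) = U" and c: "balanced I c"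
    from c have "M c \<in> span (range (\<lambda>k. \<phi> (f k)))"
      unfolding f by (auto simp: U_def)
    then obtain u where u: "M c = (\<Sum>k\<in>UNIV. u k *\<^sub>R \<phi> (f k))"
      using span_image_imp_sum[of _ "\<lambda>k. \<phi> (f k)" UNIV] by auto
    have "c a b = (\<Sum>k\<in>UNIV. u k * (f k a * f k b))" if ab: "a \<in> I" "b \<in> I" for a b
    proof -
      have "c a b = (\<Sum>k\<in>UNIV. u k *\<^sub>R \<phi> (f k)) \<bullet> E a b"
        unfolding u[symmetric] by (rule entry[OF ab, symmetric])
      then show ?thesis
        by (simp add: inner_sum_left \<phi>_def entry[OF ab])
    qed
    then show "\<exists>u::'n \<Rightarrow> real. \<forall>a\<in>I. \<forall>b\<in>I. (\<Sum>k\<in>UNIV. u k * (f k a * f k b)) = c a b"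
      by (intro exI[of _ u]) simp
  qed simp
  finally show ?thesis .
qed

section \<open>The random face\<close>

lemma sbern_pmf_half: "sbern_pmf (1/2) = pmf_of_set {1, -1}"
proof -
  have "bij_betw (\<lambda>b. if b then 1 else - 1 :: real) UNIV {1, -1}"
    by (auto simp: bij_betw_def inj_on_def UNIV_bool)
  then show ?thesis
    unfolding sbern_pmf_def bernoulli_pmf_half_conv_pmf_of_set
    by (intro map_pmf_of_set_bij_betw) auto
qed

lemma sbern_vec_pmf_half:
  "sbern_vec_pmf (1/2) = pmf_of_set {x::real^'n. \<forall>k. x $ k \<in> {1, -1}}"
proof -
  have "bij_betw vec_lambda (PiE_dflt UNIV 0 (\<lambda>_. {1, -1})) {x::real^'n. \<forall>k. x $ k \<in> {1, -1}}"
    by (rule bij_betwI[of _ _ _ vec_nth]) (auto simp: PiE_dflt_def)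
  then show ?thesis
    unfolding sbern_vec_pmf_def sbern_pmf_half
    by (simp add: Pi_pmf_of_set) (intro map_pmf_of_set_bij_betw; auto intro!: finite_PiE_dflt)
qed

text \<open>Both sides are uniform on sign arrays, and transposition is a bijection between the two ways to
  store an array.\<close>

lemma sign_columns_conv_rows:
  assumes I: "finite I"
  shows "Pi_pmf I 0 (\<lambda>_. sbern_vec_pmf (1/2) :: (real^'n) pmf)
    = map_pmf (\<lambda>f i. \<chi> k. f k i) (Pi_pmf UNIV (\<lambda>_. 0) (\<lambda>_. pmf_of_set (sign_cube I)))"
proof -
  let ?V = "{x::real^'n. \<forall>k. x $ k \<in> {1, -1}}"
  have finV: "finite ?V"
  proof -
    have "?V = vec_lambda ` (PiE_dflt UNIV 0 (\<lambda>_. {1, -1}))"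
      by (auto simp: PiE_dflt_def image_iff intro!: exI[of _ "vec_nth _"])
    then show ?thesis by (auto intro!: finite_PiE_dflt)
  qed
  have "(\<chi> k. 1) \<in> ?V" by simp
  then have neV: "?V \<noteq> {}" by blast
  have "bij_betw (\<lambda>f i. \<chi> k. f k i) (PiE_dflt UNIV (\<lambda>_. 0) (\<lambda>_::'n. sign_cube I)) (PiE_dflt I 0 (\<lambda>_. ?V))"
    by (rule bij_betwI[of _ _ _ "\<lambda>x k i. x i $ k"])
       (auto simp: PiE_dflt_def sign_cube_def vec_eq_iff)
  then have "map_pmf (\<lambda>f i. \<chi> k. f k i) (pmf_of_set (PiE_dflt UNIV (\<lambda>_. 0) (\<lambda>_::'n. sign_cube I)))
      = pmf_of_set (PiE_dflt I 0 (\<lambda>_. ?V))"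
    by (rule map_pmf_of_set_bij_betw) (auto simp: sign_cube_nonempty intro!: finite_PiE_dflt finite_sign_cube I)
  then show ?thesis
    using I finV neV unfolding sbern_vec_pmf_half
    by (simp add: Pi_pmf_of_set sign_cube_nonempty finite_sign_cube)
qed

theorem theorem2p9:
  fixes r :: nat
  assumes "r \<ge> 1"
  shows "measure_pmf.prob (face_pmf (1/2) r :: (real^'n^'n) set pmf)
           {F. simplicial_face_of (int r - 1) F elliptope}
         \<ge> 1 - (real r)\<^sup>2 * exp (- real CARD('n) / (real r)\<^sup>2)"
proof (cases "r \<le> CARD('n)")
  \<comment> \<open>For \<open>r > n\<close> the bound is trivial: \<open>n / r\<^sup>2 \<le> 1 / 2\<close> and \<open>r\<^sup>2 \<ge> 4\<close>, so the right side is negative.\<close>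
  case False
  have n: "1 \<le> CARD('n)" by (simp add: Suc_le_eq)
  then have r: "2 \<le> r" using False by linarith
  have "real CARD('n) * 2 \<le> real r * real r"
    using False r by (intro mult_mono) auto
  then have "real CARD('n) / (real r)\<^sup>2 \<le> 1 / 2"
    using r by (simp add: field_simps power2_eq_square)
  then have "1 / 2 \<le> exp (- real CARD('n) / (real r)\<^sup>2)"
    using exp_ge_add_one_self[of "- real CARD('n) / (real r)\<^sup>2"] by simp
  moreover have "4 \<le> (real r)\<^sup>2"
    using power_mono[of 2 "real r" 2] r by simp
  ultimately have "4 * (1 / 2) \<le> (real r)\<^sup>2 * exp (- real CARD('n) / (real r)\<^sup>2)"
    by (intro mult_mono) auto
  then show ?thesis
    using measure_nonneg[of "measure_pmf (face_pmf (1/2) r :: (real^'n^'n) set pmf)"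
        "{F. simplicial_face_of (int r - 1) F elliptope}"] by linarith
next
  case True
  let ?I = "{1..r}"
  let ?P = "Pi_pmf (UNIV :: 'n set) (\<lambda>_. 0) (\<lambda>_. pmf_of_set (sign_cube ?I))"
  let ?s = "\<lambda>(f :: 'n \<Rightarrow> nat \<Rightarrow> real) i. \<chi> k. f k i"
  have law: "face_pmf (1/2) r = map_pmf (\<lambda>f. convex hull ((\<lambda>i. outer_square (?s f i)) ` ?I)) ?P"
    by (simp add: face_pmf_def sign_columns_conv_rows map_pmf_comp)
  have setP: "set_pmf ?P = PiE_dflt UNIV (\<lambda>_. 0) (\<lambda>_. sign_cube ?I)"
    by (simp add: set_Pi_pmf o_def set_pmf_of_set sign_cube_nonempty finite_sign_cube)
  have "1 - (real r)\<^sup>2 * exp (- real CARD('n) / (real r)\<^sup>2) \<le> measure_pmf.prob ?P {f. rows_span_balanced ?I f}"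
    using prob_rows_span_balanced[of ?I "\<lambda>_. 0", where 'n = 'n] assms True by simp
  also have "\<dots> \<le> measure_pmf.prob ?P
      {f. simplicial_face_of (int r - 1) (convex hull ((\<lambda>i. outer_square (?s f i)) ` ?I)) elliptope}"
  proof (rule measure_pmf.finite_measure_mono_AE, unfold AE_measure_pmf_iff, intro ballI impI)
    fix f assume f: "f \<in> set_pmf ?P" "f \<in> {f. rows_span_balanced ?I f}"
    interpret balanced_sign_vectors ?I "?s f"
    proof
      show "?s f i $ k \<in> {1, -1}" if "i \<in> ?I" for i k
        using f(1) that unfolding setP by (auto simp: PiE_dflt_def sign_cube_def)
    qed (use f(2) in simp_all)
    show "f \<in> {f. simplicial_face_of (int r - 1) (convex hull ((\<lambda>i. outer_square (?s f i)) ` ?I)) elliptope}"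
      using simplicial_face_of_elliptope by simp
  qed simp
  also have "\<dots> = measure_pmf.prob (face_pmf (1/2) r :: (real^'n^'n) set pmf)
      {F. simplicial_face_of (int r - 1) F elliptope}"
    by (simp add: law vimage_def)
  finally show ?thesis .
qed

end
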